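(* Let $d\ge 2$ and let $\mathfrak{w}:\mathbb{Z}_d\times\mathbb{Z}_d\to\mathbb{C}$ be a weight with $\mathfrak{w}(0,0)=1$ such that $\mathsf{M}^{\mathfrak{w}}$ is a density operator (positive with unit trace). For every $f:\mathbb{Z}_d\times\mathbb{Z}_d\to\mathbb{C}$, the semi-classical portrait $\check f(m,n):=\mathrm{Tr}\left(A^{\mathfrak{w}}_f\,\mathsf{M}^{\mathfrak{w}}(m,n)\right)$ of the operator $A^{\mathfrak{w}}_f$ with respect to $\mathfrak{w}$ is given, for all $(m,n)\in\mathbb{Z}_d\times\mathbb{Z}_d$, by $$\check f(m,n)=\frac1d\sum_{(m',n')\in\mathbb{Z}_d\times\mathbb{Z}_d}f(m-m',n-n')\,\mathrm{Tr}\left(\mathsf{M}^{\mathfrak{w}}(m',n')\,\mathsf{M}^{\mathfrak{w}}\right).$$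
   Context: $\mathbb{Z}_d=\mathbb{Z}/d\mathbb{Z}$. $L^2(\mathbb{Z}_d)$ is the space of functions $\psi:\mathbb{Z}_d\to\mathbb{C}$ with $\langle\phi_1|\phi_2\rangle=\sum_{l\in\mathbb{Z}_d}\overline{\phi_1(l)}\phi_2(l)$. For $(m,n)\in\mathbb{Z}_d\times\mathbb{Z}_d$ the Weyl displacement operator is the unitary $(U(m,n)\psi)(l)=\varepsilon(m,n)\,e^{\mathsf{i}\frac{2\pi}{d}ml}\,\psi(l-n)$, where $\varepsilon(m,n)$ is the phase denoted $e^{-\mathsf{i}\frac{\pi}{d}mn}$, with the following convention: if $d$ is odd, $\frac12$ is read as the inverse $\frac{d+1}{2}$ of $2$ in $\mathbb{Z}_d$, so $\varepsilon(m,n)=e^{-\mathsf{i}\frac{2\pi}{d}\frac{d+1}{2}mn}$; if $d$ is even, $m,n$ are represented by integers in $\{0,\dots,d-1\}$ and $\varepsilon(m,n)=e^{-\mathsf{i}\frac{\pi}{d}mn}$. For a weight $\mathfrak{w}$ (any complex function on $\mathbb{Z}_d\times\mathbb{Z}_d$), $\mathsf{M}^{\mathfrak{w}}=\frac1d\sum_{(m,n)}\mathfrak{w}(m,n)\,U(m,n)$, $\mathsf{M}^{\mathfrak{w}}(m,n)=U(m,n)\,\mathsf{M}^{\mathfrak{w}}\,U(m,n)^\dagger$, and for $f:\mathbb{Z}_d\times\mathbb{Z}_d\to\mathbb{C}$, $A^{\mathfrak{w}}_f=\frac1d\sum_{(m,n)\in\mathbb{Z}_d\times\mathbb{Z}_d}f(m,n)\,\mathsf{M}^{\mathfrak{w}}(m,n)$.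 *)

theory Defs
  imports "HOL-Analysis.Analysis" "Berlekamp_Zassenhaus.Finite_Field"
begin

text \<open>
  The ring \<open>\<int>/d\<int>\<close> is the type \<open>'d mod_ring\<close> with \<open>d = CARD('d)\<close>;
  \<open>to_int_mod_ring\<close> picks the representative in \<open>{0, \<dots>, d - 1}\<close>.
\<close>

type_synonym 'd L2 = "complex ^ 'd mod_ring"
type_synonym 'd operator = "'d L2 \<Rightarrow> 'd L2"

definition braket :: "'d::finite L2 \<Rightarrow> 'd L2 \<Rightarrow> complex" where
  "braket \<phi> \<psi> = (\<Sum>l\<in>UNIV. cnj (\<phi> $ l) * \<psi> $ l)"

text \<open>
  The library's \<open>adjoint\<close> refers to the real inner product, hence a separate
  definition for the complex one.
\<close>

definition cadjoint :: "'d::finite operator \<Rightarrow> 'd operator" where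
  "cadjoint T = (THE S. \<forall>\<phi> \<psi>. braket \<phi> (T \<psi>) = braket (S \<phi>) \<psi>)"

definition op_trace :: "'d::finite operator \<Rightarrow> complex" where
  "op_trace T = trace (matrix T)"

definition positive_op :: "'d::finite operator \<Rightarrow> bool" where
  "positive_op T \<longleftrightarrow> Vector_Spaces.linear (*s) (*s) T \<and>
     (\<forall>\<psi>. braket \<psi> (T \<psi>) \<in> \<real> \<and> 0 \<le> Re (braket \<psi> (T \<psi>)))"

definition density_op :: "'d::finite operator \<Rightarrow> bool" where
  "density_op T \<longleftrightarrow> positive_op T \<and> op_trace T = 1"

text \<open>
  The phase written \<open>exp (- i \<pi> m n / d)\<close>: for odd \<open>d\<close> the factor \<open>1/2\<close> in
  \<open>exp (- (2 \<pi> i / d) (1/2) m n)\<close> is the inverse \<open>(d + 1)/2\<close> of \<open>2\<close> modulo \<open>d\<close>;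
  for even \<open>d\<close> the value depends on the chosen representatives.
\<close>

definition weyl_phase :: "'d::finite mod_ring \<Rightarrow> 'd mod_ring \<Rightarrow> complex" where
  "weyl_phase m n =
     (if odd CARD('d)
      then cis (- (2 * pi / real CARD('d)) * real ((CARD('d) + 1) div 2)
             * of_int (to_int_mod_ring m) * of_int (to_int_mod_ring n))
      else cis (- (pi / real CARD('d))
             * of_int (to_int_mod_ring m) * of_int (to_int_mod_ring n)))"

definition weyl :: "'d::finite mod_ring \<times> 'd mod_ring \<Rightarrow> 'd operator" where
  "weyl = (\<lambda>(m, n) \<psi>. \<chi> l. weyl_phase m n
     * cis (2 * pi / real CARD('d) * of_int (to_int_mod_ring m) * of_int (to_int_mod_ring l))
     * \<psi> $ (l - n))"

definition weight_op :: "('d::finite mod_ring \<times> 'd mod_ring \<Rightarrow> complex) \<Rightarrow> 'd operator" where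
  "weight_op w \<psi> = (1 / of_nat CARD('d)) *s (\<Sum>(m, n)\<in>UNIV. w (m, n) *s weyl (m, n) \<psi>)"

definition weight_op_at ::
  "('d::finite mod_ring \<times> 'd mod_ring \<Rightarrow> complex) \<Rightarrow> 'd mod_ring \<times> 'd mod_ring \<Rightarrow> 'd operator" where
  "weight_op_at w p = weyl p \<circ> weight_op w \<circ> cadjoint (weyl p)"

definition quantized_op ::
  "('d::finite mod_ring \<times> 'd mod_ring \<Rightarrow> complex) \<Rightarrow> ('d mod_ring \<times> 'd mod_ring \<Rightarrow> complex)
    \<Rightarrow> 'd operator" where
  "quantized_op w f \<psi> =
     (1 / of_nat CARD('d)) *s (\<Sum>(m, n)\<in>UNIV. f (m, n) *s weight_op_at w (m, n) \<psi>)"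

definition portrait ::
  "('d::finite mod_ring \<times> 'd mod_ring \<Rightarrow> complex) \<Rightarrow> ('d mod_ring \<times> 'd mod_ring \<Rightarrow> complex)
    \<Rightarrow> 'd mod_ring \<times> 'd mod_ring \<Rightarrow> complex" where
  "portrait w f p = op_trace (quantized_op w f \<circ> weight_op_at w p)"

end

(* Conjugation by a Weyl operator ignores its phase: in the position basis it translates
   the matrix of an operator along the diagonal and multiplies it by a character,
   (l, k) |-> e^(2 pi i m (l - k) / d) T(l - n, k - n).  Hence conjugation is an action of the group
   of pairs, and shifting both summation indices in the trace gives
   Tr (M(a,b) M(m,n)) = Tr (M(m-a,n-b) M); the formula follows by reindexing the sum that
   defines the quantized operator. *)
theory Submission
  imports Defs
begin

text \<open>Representatives congruent modulo d change the angle by a multiple of 2 pi, so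
  exponentials may be computed with unreduced integers.\<close>

lemma cis_int_cong:
  fixes a b :: int
  assumes "a mod int d = b mod int d" and "d > 0"
  shows "cis (2 * pi / real d * of_int a) = cis (2 * pi / real d * of_int b)"
proof -
  obtain q where q: "a = b + int d * q"
    using assms(1) by (metis mod_eqE)
  have "2 * pi / real d * of_int a = 2 * pi / real d * of_int b + 2 * pi * of_int q"
    using assms(2) by (simp add: q field_simps)
  then show ?thesis
    by (simp add: cis_mult [symmetric])
qed

text \<open>The standard symmetric bicharacter of the residue ring. The product is formed in the
  integers before the cast, so that \<open>cis_int_cong\<close> applies to it.\<close>

definition mod_ring_char :: "'d::finite mod_ring \<Rightarrow> 'd mod_ring \<Rightarrow> complex" where
  "mod_ring_char m x =
     cis (2 * pi / real CARD('d) * of_int (to_int_mod_ring m * to_int_mod_ring x))"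

lemma mod_ring_char_commute: "mod_ring_char m x = mod_ring_char x m"
  by (simp add: mod_ring_char_def mult.commute)

lemma to_int_mod_ring_add:
  "to_int_mod_ring (x + y :: 'd::finite mod_ring)
     = (to_int_mod_ring x + to_int_mod_ring y) mod int CARD('d)"
  by transfer simp

lemma mod_ring_char_add_right:
  fixes m :: "'d::finite mod_ring"
  shows "mod_ring_char m (x + y) = mod_ring_char m x * mod_ring_char m y"
proof -
  have "mod_ring_char m (x + y) = cis (2 * pi / real CARD('d) *
      of_int (to_int_mod_ring m * (to_int_mod_ring x + to_int_mod_ring y)))"
    unfolding mod_ring_char_def to_int_mod_ring_add
    by (rule cis_int_cong) (simp_all add: mod_simps)
  also have "\<dots> = mod_ring_char m x * mod_ring_char m y"
    by (simp add: mod_ring_char_def cis_mult algebra_simps)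
  finally show ?thesis .
qed

lemma mod_ring_char_nonzero: "mod_ring_char m x \<noteq> 0"
  by (simp add: mod_ring_char_def)

lemma mod_ring_char_diff_right:
  "mod_ring_char m (x - y) = mod_ring_char m x / mod_ring_char m y"
  using mod_ring_char_add_right [of m "x - y" y]
  by (simp add: mod_ring_char_nonzero field_simps)

lemma mod_ring_char_diff_left:
  "mod_ring_char (m - a) x = mod_ring_char m x / mod_ring_char a x"
  by (simp add: mod_ring_char_commute [of _ x] mod_ring_char_diff_right)

lemma cnj_mod_ring_char: "cnj (mod_ring_char m x) = 1 / mod_ring_char m x"
  by (simp add: mod_ring_char_def cis_cnj divide_inverse)

text \<open>For either parity of d the phase is some \<open>cis t\<close>, hence of modulus one.
  Conjugation by a Weyl operator uses only this fact about it.\<close>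

lemma weyl_phase_mult_cnj: "weyl_phase m n * cnj (weyl_phase m n) = 1"
  by (simp add: weyl_phase_def cis_cnj cis_mult)

lemma weyl_nth:
  "weyl (m, n) \<psi> $ l = weyl_phase m n * mod_ring_char m l * \<psi> $ (l - n)"
  by (simp add: weyl_def mod_ring_char_def mult.assoc)

lemma sum_UNIV_diff:
  fixes g :: "'a::{ab_group_add, finite} \<Rightarrow> 'b::comm_monoid_add"
  shows "(\<Sum>x\<in>UNIV. g (x - c)) = (\<Sum>x\<in>UNIV. g x)"
  by (rule sum.reindex_bij_witness [of _ "\<lambda>x. x + c" "\<lambda>x. x - c"]) auto

lemma braket_axis: "braket \<phi> (axis j 1) = cnj (\<phi> $ j)"
  by (simp add: braket_def axis_def if_distrib cong: if_cong)

text \<open>The definite description needs uniqueness: pairing with the basis vector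
  \<open>axis j 1\<close> recovers the j-th coordinate of any candidate adjoint, up to
  conjugation.\<close>

lemma cadjoint_eqI:
  assumes "\<And>\<phi> \<psi>. braket \<phi> (T \<psi>) = braket (S \<phi>) \<psi>"
  shows "cadjoint T = S"
  unfolding cadjoint_def
proof (rule the_equality)
  fix R assume R: "\<forall>\<phi> \<psi>. braket \<phi> (T \<psi>) = braket (R \<phi>) \<psi>"
  have "R \<phi> $ j = S \<phi> $ j" for \<phi> j
    using R assms [of \<phi> "axis j 1"] by (metis braket_axis complex_cnj_cancel_iff)
  then show "R = S"
    by (simp add: fun_eq_iff vec_eq_iff)
qed (use assms in blast)

lemma cadjoint_weyl:
  "cadjoint (weyl (m, n)) =
     (\<lambda>\<phi>. \<chi> l. cnj (weyl_phase m n * mod_ring_char m (l + n)) * \<phi> $ (l + n))"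
proof (rule cadjoint_eqI)
  fix \<phi> \<psi> :: "'a L2"
  show "braket \<phi> (weyl (m, n) \<psi>) =
      braket (\<chi> l. cnj (weyl_phase m n * mod_ring_char m (l + n)) * \<phi> $ (l + n)) \<psi>"
    unfolding braket_def weyl_nth
    \<comment> \<open>A shift of the summation index by \<open>n\<close> carries the translation
      from one argument of the pairing to the other.\<close>
    by (subst sum_UNIV_diff [of _ n, symmetric]) (simp add: mult_ac)
qed

lemma linear_vecI:
  fixes T :: "'a::field ^ 'n \<Rightarrow> 'a ^ 'm"
  assumes "\<And>x y. T (x + y) = T x + T y" and "\<And>c x. T (c *s x) = c *s T x"
  shows "Vector_Spaces.linear (*s) (*s) T"
  by unfold_locales
    (simp_all add: assms vec_eq_iff algebra_simps)

lemma linear_weyl: "Vector_Spaces.linear (*s) (*s) (weyl p)"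
  by (cases p) (auto intro!: linear_vecI simp: vec_eq_iff weyl_nth algebra_simps)

lemma linear_cadjoint_weyl: "Vector_Spaces.linear (*s) (*s) (cadjoint (weyl p))"
  by (cases p) (auto intro!: linear_vecI simp: vec_eq_iff cadjoint_weyl algebra_simps)

lemma linear_weight_op: "Vector_Spaces.linear (*s) (*s) (weight_op w)"
proof (rule linear_vecI)
  fix x y :: "'a L2" and c :: complex
  show "weight_op w (x + y) = weight_op w x + weight_op w y"
    by (simp add: weight_op_def vec_eq_iff weyl_nth split_def weyl_def sum.distrib algebra_simps)
  show "weight_op w (c *s x) = c *s weight_op w x"
    by (simp add: weight_op_def vec_eq_iff split_def weyl_def sum_distrib_left algebra_simps)
qed

lemma linear_weight_op_at: "Vector_Spaces.linear (*s) (*s) (weight_op_at w p)"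
  unfolding weight_op_at_def
  by (rule Vector_Spaces.linear_compose [OF linear_cadjoint_weyl
        Vector_Spaces.linear_compose [OF linear_weight_op linear_weyl]])

text \<open>Weyl operators permute the basis up to scalars: the adjoint moves
  \<open>axis k 1\<close> to index \<open>k - n\<close>, and the outer operator reads row
  \<open>l\<close> off at \<open>l - n\<close>. Only the scalars remain to be collected.\<close>

lemma matrix_conj_weyl:
  assumes "Vector_Spaces.linear (*s) (*s) T"
  shows "matrix (weyl (m, n) \<circ> T \<circ> cadjoint (weyl (m, n))) $ l $ k =
    mod_ring_char m (l - k) * matrix T $ (l - n) $ (k - n)"
proof -
  have "cadjoint (weyl (m, n)) (axis k 1) =
      cnj (weyl_phase m n * mod_ring_char m k) *s axis (k - n) 1"
    by (auto simp: vec_eq_iff cadjoint_weyl axis_def algebra_simps)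
  then have "matrix (weyl (m, n) \<circ> T \<circ> cadjoint (weyl (m, n))) $ l $ k =
      weyl_phase m n * mod_ring_char m l * (cnj (weyl_phase m n * mod_ring_char m k)
        * matrix T $ (l - n) $ (k - n))"
    by (simp add: matrix_def weyl_nth vec.linear_scale [OF assms])
  \<comment> \<open>The phase meets its own conjugate and cancels; the two character values form a
    quotient, the character at \<open>l - k\<close>.\<close>
  also have "\<dots> = (weyl_phase m n * cnj (weyl_phase m n)) *
      (mod_ring_char m l * cnj (mod_ring_char m k)) * matrix T $ (l - n) $ (k - n)"
    by (simp add: mult_ac)
  finally show ?thesis
    by (simp add: weyl_phase_mult_cnj cnj_mod_ring_char mod_ring_char_diff_right)
qed

lemma matrix_weight_op_at:
  "matrix (weight_op_at w (m, n)) $ l $ k =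
    mod_ring_char m (l - k) * matrix (weight_op w) $ (l - n) $ (k - n)"
  unfolding weight_op_at_def by (rule matrix_conj_weyl [OF linear_weight_op])

lemma op_trace_compose:
  assumes "Vector_Spaces.linear (*s) (*s) S" and "Vector_Spaces.linear (*s) (*s) T"
  shows "op_trace (S \<circ> T) = (\<Sum>l\<in>UNIV. \<Sum>k\<in>UNIV. matrix S $ l $ k * matrix T $ k $ l)"
  by (simp add: op_trace_def matrix_compose_gen [OF assms(2,1)] trace_def matrix_matrix_mult_def)

lemma op_trace_weight_op_at_compose:
  "op_trace (weight_op_at w (a, b) \<circ> weight_op_at w (m, n)) =
    op_trace (weight_op_at w (m - a, n - b) \<circ> weight_op w)"
proof -
  let ?A = "matrix (weight_op w)"
  \<comment> \<open>The two matrix entries carry opposite index differences, so the character of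
    \<open>a\<close> enters inverted.\<close>
  have char: "mod_ring_char a (l - k) * mod_ring_char m (k - l) = mod_ring_char (m - a) (k - l)"
    for l k
    by (simp add: mod_ring_char_diff_left mod_ring_char_diff_right mod_ring_char_nonzero)
  \<comment> \<open>Chosen so that \<open>g (l - b) (k - b)\<close> is the summand of the left
    trace: the character sees only \<open>k - l\<close>, and
    \<open>(k - b) - (n - b) = k - n\<close>.\<close>
  define g where "g l k = mod_ring_char (m - a) (k - l) * ?A $ l $ k
      * ?A $ (k - (n - b)) $ (l - (n - b))" for l k
  have "op_trace (weight_op_at w (a, b) \<circ> weight_op_at w (m, n)) =
      (\<Sum>l\<in>UNIV. \<Sum>k\<in>UNIV. g (l - b) (k - b))"
    unfolding op_trace_compose [OF linear_weight_op_at linear_weight_op_at]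
    by (intro sum.cong refl) (simp add: matrix_weight_op_at g_def char [symmetric] mult_ac)
  also have "\<dots> = (\<Sum>l\<in>UNIV. \<Sum>k\<in>UNIV. g l k)"
    by (simp only: sum_UNIV_diff [of "g _"] sum_UNIV_diff [of "\<lambda>l. \<Sum>k\<in>UNIV. g l k"])
  \<comment> \<open>Cyclicity of the trace: the displaced operator is the second factor in
    \<open>g\<close> but the first in the target.\<close>
  also have "\<dots> = (\<Sum>k\<in>UNIV. \<Sum>l\<in>UNIV. g l k)"
    by (rule sum.swap)
  also have "\<dots> = op_trace (weight_op_at w (m - a, n - b) \<circ> weight_op w)"
    unfolding op_trace_compose [OF linear_weight_op_at linear_weight_op]
    by (intro sum.cong refl) (simp add: matrix_weight_op_at g_def mult_ac)
  finally show ?thesis .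
qed

text \<open>The trace involves \<open>T\<close> only through the vectors
  \<open>T (axis i 1)\<close>, at which the quantized operator is a finite combination; exchanging
  the two sums suffices, for any map \<open>T\<close>.\<close>

lemma op_trace_quantized_op_compose:
  fixes w :: "'d::finite mod_ring \<times> 'd mod_ring \<Rightarrow> complex"
  shows "op_trace (quantized_op w f \<circ> T) =
    (1 / of_nat CARD('d)) * (\<Sum>p\<in>UNIV. f p * op_trace (weight_op_at w p \<circ> T))"
proof -
  have "op_trace (quantized_op w f \<circ> T) =
      (\<Sum>i\<in>UNIV. (1 / of_nat CARD('d)) *
        (\<Sum>p\<in>UNIV. f p * weight_op_at w p (T (axis i 1)) $ i))"
    by (simp add: op_trace_def trace_def matrix_def quantized_op_def split_def)
  also have "\<dots> = (1 / of_nat CARD('d)) *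
      (\<Sum>p\<in>UNIV. \<Sum>i\<in>UNIV. f p * weight_op_at w p (T (axis i 1)) $ i)"
    by (subst sum.swap) (rule sum_distrib_left [symmetric])
  finally show ?thesis
    by (simp add: op_trace_def trace_def matrix_def sum_distrib_left)
qed

theorem proposition5p1:
  fixes w f :: "'d::finite mod_ring \<times> 'd mod_ring \<Rightarrow> complex"
    and m n :: "'d mod_ring"
  assumes "CARD('d) \<ge> 2"
    and "w (0, 0) = 1"
    and "density_op (weight_op w)"
  shows "portrait w f (m, n) =
    (1 / of_nat CARD('d)) * (\<Sum>(m', n')\<in>UNIV.
       f (m - m', n - n') * op_trace (weight_op_at w (m', n') \<circ> weight_op w))"
proof -
  have "(\<Sum>p\<in>UNIV. f p * op_trace (weight_op_at w p \<circ> weight_op_at w (m, n))) =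
      (\<Sum>(m', n')\<in>UNIV.
        f (m - m', n - n') * op_trace (weight_op_at w (m', n') \<circ> weight_op w))"
    \<comment> \<open>The reflection of the phase space that exchanges p and (m, n) - p is an
      involution, so it serves as both witnesses.\<close>
    by (rule sum.reindex_bij_witness [of _ "\<lambda>(a, b). (m - a, n - b)" "\<lambda>(a, b). (m - a, n - b)"])
      (auto simp: op_trace_weight_op_at_compose)
  then show ?thesis
    by (simp add: portrait_def op_trace_quantized_op_compose)
qed

end
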